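(* Let $\mathbf{a}\in[n]^n$. For any covering relation $w\mathrel{\lessdot}w'$ of the partial order $\lesssim_{\mathbf{a}}$ on $S_n$ (i.e. $w\lesssim_{\mathbf{a}}w'$, $w\ne w'$, and no $z\notin\{w,w'\}$ satisfies $w\lesssim_{\mathbf{a}}z\lesssim_{\mathbf{a}}w'$), we have $\ell_{\mathbf{a}}(w')=\ell_{\mathbf{a}}(w)+1$. Consequently, $(S_n,\lesssim_{\mathbf{a}})$ is a ranked poset with rank function $\ell_{\mathbf{a}}$.
   Context: Permutations are in one-line notation $w=w_1\cdots w_n$, $w[k]:=\{w_1,\dots,w_k\}$. Cyclic interval $[a,b)_c$: $\{a,\dots,b-1\}$ if $a\le b$, $\{a,\dots,n\}\cup\{1,\dots,b-1\}$ if $a>b$. For $r\in[n]$, $<_r$ is the total order $r<_r r+1<_r\cdots<_r n<_r 1<_r\cdots<_r r-1$ on $[n]$; for $k$-subsets $A=\{a_1<_r\cdots<_r a_k\}$, $B=\{b_1<_r\cdots<_r b_k\}$, $A\le_r B$ means $a_i\le_r b_i$ for all $i$. For $\mathbf{a}=(a_1,\dots,a_n)\in[n]^n$: $u\lesssim_{\mathbf{a}}v$ iff $u[k]\le_{a_k}v[k]$ for all $k\in[n]$ and $|u[k]\cap[a_k,a_{k+1})_c|=|v[k]\cap[a_k,a_{k+1})_c|$ for all $k\in[n-1]$; this is a partial order on $S_n$. The $\mathbf{a}$-tilted length is $\ell_{\mathbf{a}}(w):=\#\{(i,j):1\le i<j\le n,\ w_i>_{a_i}w_j\}$. *)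

theory Defs
  imports "HOL-Combinatorics.Permutations" "HOL-Library.FuncSet"
begin

text \<open>
  \<open>S\<^sub>n\<close> is rendered as the set of all \<open>w\<close> with \<open>w permutes {1..n}\<close>; the one-line entry
  \<open>w\<^sub>i\<close> is \<open>w i\<close>. A tuple in \<open>[n]\<^sup>n\<close> is a function in \<open>{1..n} \<rightarrow> {1..n}\<close>, of which only the
  values on \<open>{1..n}\<close> are ever used.
\<close>

definition prefix_set :: "(nat \<Rightarrow> nat) \<Rightarrow> nat \<Rightarrow> nat set" where
  "prefix_set w k = w ` {1..k}"

text \<open>Half-open; in particular it is empty (not all of \<open>[n]\<close>) when \<open>a = b\<close>.\<close>

definition cyc_interval :: "nat \<Rightarrow> nat \<Rightarrow> nat \<Rightarrow> nat set" where
  "cyc_interval n a b = (if a \<le> b then {a..<b} else {a..n} \<union> {1..<b})"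

text \<open>
  The order \<open>r < r+1 < \<dots> < n < 1 < \<dots> < r-1\<close>: numbers \<open>\<ge> r\<close> precede numbers \<open>< r\<close>, and
  within either group the order is the usual one. This description does not involve \<open>n\<close>.
\<close>

definition cyc_less :: "nat \<Rightarrow> nat \<Rightarrow> nat \<Rightarrow> bool" where
  "cyc_less r x y \<longleftrightarrow> (if r \<le> x \<longleftrightarrow> r \<le> y then x < y else r \<le> x)"

definition cyc_le :: "nat \<Rightarrow> nat \<Rightarrow> nat \<Rightarrow> bool" where
  "cyc_le r x y \<longleftrightarrow> cyc_less r x y \<or> x = y"

lemma sorted_wrt_cyc_less: "sorted_wrt (cyc_less r) ([r..<Suc n] @ [1..<r])"
proof -
  have "sorted_wrt (cyc_less r) [r..<Suc n]"
    by (rule sorted_wrt_mono_rel[OF _ sorted_wrt_upt]) (auto simp: cyc_less_def)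
  moreover have "sorted_wrt (cyc_less r) [1..<r]"
    by (rule sorted_wrt_mono_rel[OF _ sorted_wrt_upt]) (auto simp: cyc_less_def)
  ultimately show ?thesis
    by (auto simp: sorted_wrt_append cyc_less_def simp del: upt_Suc)
qed

text \<open>
  The lists below are the (unique) increasing enumerations of \<open>A\<close> and \<open>B\<close>; the relation
  forces \<open>A\<close> and \<open>B\<close> to be finite and of equal cardinality.
\<close>

definition subset_le :: "nat \<Rightarrow> nat set \<Rightarrow> nat set \<Rightarrow> bool" where
  "subset_le r A B \<longleftrightarrow>
     (\<exists>xs ys. sorted_wrt (cyc_less r) xs \<and> set xs = A \<and>
              sorted_wrt (cyc_less r) ys \<and> set ys = B \<and>
              list_all2 (cyc_le r) xs ys)"

definition tilted_le :: "nat \<Rightarrow> (nat \<Rightarrow> nat) \<Rightarrow> (nat \<Rightarrow> nat) \<Rightarrow> (nat \<Rightarrow> nat) \<Rightarrow> bool" where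
  "tilted_le n a u v \<longleftrightarrow>
     (\<forall>k\<in>{1..n}. subset_le (a k) (prefix_set u k) (prefix_set v k)) \<and>
     (\<forall>k\<in>{1..<n}. card (prefix_set u k \<inter> cyc_interval n (a k) (a (k + 1))) =
                  card (prefix_set v k \<inter> cyc_interval n (a k) (a (k + 1))))"

definition tilted_order :: "nat \<Rightarrow> (nat \<Rightarrow> nat) \<Rightarrow> (nat \<Rightarrow> nat) rel" where
  "tilted_order n a = relation_of (tilted_le n a) {w. w permutes {1..n}}"

definition tilted_length :: "nat \<Rightarrow> (nat \<Rightarrow> nat) \<Rightarrow> (nat \<Rightarrow> nat) \<Rightarrow> nat" where
  "tilted_length n a w =
     card {(i, j). 1 \<le> i \<and> i < j \<and> j \<le> n \<and> cyc_less (a i) (w j) (w i)}"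

definition covered_by :: "'a rel \<Rightarrow> 'a \<Rightarrow> 'a \<Rightarrow> bool" where
  "covered_by r x y \<longleftrightarrow>
     (x, y) \<in> r \<and> x \<noteq> y \<and> (\<nexists>z. z \<notin> {x, y} \<and> (x, z) \<in> r \<and> (z, y) \<in> r)"

text \<open>
  A rank function is strictly monotone and increases by one along covering relations. It is not
  required to vanish on minimal elements: already for \<open>n = 2\<close> and \<open>a = (1, 2)\<close> both permutations
  are minimal, of tilted lengths \<open>0\<close> and \<open>1\<close>.
\<close>

definition ranked_poset_on :: "'a set \<Rightarrow> 'a rel \<Rightarrow> ('a \<Rightarrow> nat) \<Rightarrow> bool" where
  "ranked_poset_on A r \<rho> \<longleftrightarrow>
     partial_order_on A r \<and>
     (\<forall>x y. (x, y) \<in> r \<and> x \<noteq> y \<longrightarrow> \<rho> x < \<rho> y) \<and>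
     (\<forall>x y. covered_by r x y \<longrightarrow> \<rho> y = \<rho> x + 1)"

end

theory Submission
  imports Defs
begin

text \<open>
  For \<open>u, v\<close> let \<open>d k x = |u[k] \<inter> [1,x)| - |v[k] \<inter> [1,x)|\<close>. Then \<open>u \<lesssim>\<^sub>\<a> v\<close> says that \<open>d k\<close> attains
  its minimum at \<open>a\<^sub>k\<close>, and at \<open>a\<^sub>k\<^sub>+\<^sub>1\<close> as well; since \<open>d\<close> is additive along \<open>u, v, w\<close>, this is a
  partial order. If \<open>u\<close> lies strictly below \<open>v\<close>, let \<open>i\<close> be the first position where they differ
  and \<open>j > i\<close> the first position with \<open>u\<^sub>j\<close> in the half-open cyclic interval from \<open>u\<^sub>i\<close> (excluded)
  to \<open>v\<^sub>i\<close> (included). Up to position \<open>j - 1\<close> the function \<open>d k\<close> exceeds its minimum on that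
  interval, so exchanging \<open>u\<^sub>i\<close> and \<open>u\<^sub>j\<close> gives some \<open>z\<close> with \<open>u \<lesssim>\<^sub>\<a> z \<lesssim>\<^sub>\<a> v\<close>. No entry between the
  positions \<open>i\<close> and \<open>j\<close>, and none of \<open>a\<^sub>i, \<dots>, a\<^sub>j\<close>, obstructs the exchange, so the tilted length grows
  by exactly one.
\<close>

text \<open>The cyclic interval \<open>(x, y]\<close>, wrapping around when \<open>y < x\<close>.
  For \<open>x = y\<close> it is the whole circle, hence the hypothesis \<open>x \<noteq> y\<close>
  in the indicator formula below.\<close>

definition cyc_between :: "nat \<Rightarrow> nat \<Rightarrow> nat \<Rightarrow> bool" where
  "cyc_between x y w \<longleftrightarrow> (if x < y then x < w \<and> w \<le> y else x < w \<or> w \<le> y)"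

text \<open>The function \<open>d k x\<close> of the overview, as a sum over positions, so that
  additivity and the effect of an exchange can be read off term by term.\<close>

definition prefix_excess :: "(nat \<Rightarrow> nat) \<Rightarrow> (nat \<Rightarrow> nat) \<Rightarrow> nat \<Rightarrow> nat \<Rightarrow> int" where
  "prefix_excess u v k x = (\<Sum>m = 1..k. of_bool (u m < x) - of_bool (v m < x))"

text \<open>Turns the cyclic comparison into plain thresholds on \<open>y\<close> plus a term free
  of \<open>y\<close>; that term cancels when \<open>u\<close> and \<open>v\<close> are
  compared.\<close>

lemma of_bool_cyc_less:
  "(of_bool (cyc_less r y x) :: int) = of_bool (y < x) - of_bool (y < r) + of_bool (x < r)"
  by (auto simp: cyc_less_def)

lemma of_bool_cyc_between:
  assumes "x \<noteq> y"
  shows "(of_bool (cyc_between x y w) :: int) = of_bool (x < w) - of_bool (y < w) + of_bool (y < x)"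
  using assms by (auto simp: cyc_between_def)

section \<open>Counting form of the subset comparison\<close>

lemma cyc_less_irrefl [simp]: "\<not> cyc_less r x x"
  by (simp add: cyc_less_def)

lemma cyc_less_trans: "cyc_less r x y \<Longrightarrow> cyc_less r y z \<Longrightarrow> cyc_less r x z"
  by (auto simp: cyc_less_def split: if_splits)

lemma cyc_less_linear: "cyc_less r x y \<or> x = y \<or> cyc_less r y x"
  by (auto simp: cyc_less_def)

lemma sorted_wrt_cyc_less_distinct:
  assumes "sorted_wrt (cyc_less r) xs"
  shows "distinct xs"
  using assms by (induction xs) auto

lemma sorted_wrt_cyc_less_nth_iff:
  assumes "sorted_wrt (cyc_less r) xs" "i < length xs" "j < length xs"
  shows "cyc_less r (xs ! i) (xs ! j) \<longleftrightarrow> i < j"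
proof (cases i j rule: linorder_cases)
  case less
  then show ?thesis using assms by (auto simp: sorted_wrt_nth_less)
next
  case greater
  then have "cyc_less r (xs ! j) (xs ! i)" using assms by (auto simp: sorted_wrt_nth_less)
  then show ?thesis using greater cyc_less_trans cyc_less_irrefl by (metis less_asym)
qed auto

lemma card_filter_set_distinct:
  assumes "distinct xs"
  shows "card {y \<in> set xs. P y} = card {i. i < length xs \<and> P (xs ! i)}"
proof -
  have "{y \<in> set xs. P y} = (!) xs ` {i. i < length xs \<and> P (xs ! i)}"
    by (auto simp: set_conv_nth)
  moreover have "inj_on ((!) xs) {i. i < length xs \<and> P (xs ! i)}"
    using assms by (auto simp: inj_on_def nth_eq_iff_index_eq)
  ultimately show ?thesis by (simp add: card_image)
qed

lemma ex_cyc_enumeration: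
  assumes "A \<subseteq> {1..n}" "r \<in> {1..n}"
  shows "\<exists>xs. sorted_wrt (cyc_less r) xs \<and> set xs = A"
proof (intro exI conjI)
  let ?xs = "filter (\<lambda>x. x \<in> A) ([r..<Suc n] @ [1..<r])"
  show "sorted_wrt (cyc_less r) ?xs"
    by (rule sorted_wrt_filter[OF sorted_wrt_cyc_less])
  show "set ?xs = A" using assms by (auto simp del: upt_Suc)
qed

text \<open>If \<open>ys ! i\<close> lies below a threshold, so does \<open>xs ! i\<close>.
  Conversely, if \<open>xs ! i\<close> came after \<open>ys ! i\<close>, the threshold
  \<open>xs ! i\<close> would have \<open>i\<close> elements of \<open>A\<close> below it but at
  least \<open>i + 1\<close> of \<open>B\<close>.\<close>

lemma subset_le_iff:
  assumes A: "A \<subseteq> {1..n}" and B: "B \<subseteq> {1..n}" and r: "r \<in> {1..n}"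
  shows "subset_le r A B \<longleftrightarrow> card A = card B \<and>
    (\<forall>x\<in>{1..n}. card {y \<in> B. cyc_less r y x} \<le> card {y \<in> A. cyc_less r y x})"
    (is "?L \<longleftrightarrow> ?R")
proof
  assume ?L
  then obtain xs ys where xs: "sorted_wrt (cyc_less r) xs" "set xs = A"
    and ys: "sorted_wrt (cyc_less r) ys" "set ys = B" and le: "list_all2 (cyc_le r) xs ys"
    by (auto simp: subset_le_def)
  have dist: "distinct xs" "distinct ys"
    using xs ys sorted_wrt_cyc_less_distinct by auto
  have len: "length xs = length ys" using le by (rule list_all2_lengthD)
  have "card {y \<in> B. cyc_less r y x} \<le> card {y \<in> A. cyc_less r y x}" for x
  proof -
    have "{i. i < length ys \<and> cyc_less r (ys ! i) x} \<subseteq> {i. i < length xs \<and> cyc_less r (xs ! i) x}"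
    proof safe
      fix i assume i: "i < length ys" "cyc_less r (ys ! i) x"
      then have "cyc_le r (xs ! i) (ys ! i)" using list_all2_nthD2[OF le] by blast
      then show "cyc_less r (xs ! i) x"
        using i cyc_less_trans unfolding cyc_le_def by auto
    qed (simp add: len)
    then have "card {i. i < length ys \<and> cyc_less r (ys ! i) x}
        \<le> card {i. i < length xs \<and> cyc_less r (xs ! i) x}"
      by (intro card_mono) auto
    then show ?thesis
      using card_filter_set_distinct[OF dist(1), of "\<lambda>y. cyc_less r y x"]
        card_filter_set_distinct[OF dist(2), of "\<lambda>y. cyc_less r y x"] xs(2) ys(2) by simp
  qed
  moreover have "card A = card B"
    using dist len xs(2) ys(2) distinct_card by metis
  ultimately show ?R by blast
next
  assume R: ?R
  obtain xs ys where xs: "sorted_wrt (cyc_less r) xs" "set xs = A"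
    and ys: "sorted_wrt (cyc_less r) ys" "set ys = B"
    using ex_cyc_enumeration A B r by metis
  have dist: "distinct xs" "distinct ys"
    using xs ys sorted_wrt_cyc_less_distinct by auto
  have len: "length xs = length ys"
    using R dist xs(2) ys(2) distinct_card by metis
  have "cyc_le r (xs ! i) (ys ! i)" if i: "i < length xs" for i
  proof (rule ccontr)
    assume "\<not> cyc_le r (xs ! i) (ys ! i)"
    then have less: "cyc_less r (ys ! i) (xs ! i)"
      using cyc_less_linear unfolding cyc_le_def by blast
    have "{j. j < length xs \<and> cyc_less r (xs ! j) (xs ! i)} = {..<i}"
      using sorted_wrt_cyc_less_nth_iff[OF xs(1) _ i] i by auto
    then have "card {y \<in> A. cyc_less r y (xs ! i)} = i"
      using card_filter_set_distinct[OF dist(1), of "\<lambda>y. cyc_less r y (xs ! i)"] xs(2) by simp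
    moreover have "{..i} \<subseteq> {j. j < length ys \<and> cyc_less r (ys ! j) (xs ! i)}"
    proof
      fix j assume "j \<in> {..i}"
      then have j: "j \<le> i" by simp
      then have "j = i \<or> cyc_less r (ys ! j) (ys ! i)"
        using sorted_wrt_cyc_less_nth_iff[OF ys(1), of j i] i len by auto
      then show "j \<in> {j. j < length ys \<and> cyc_less r (ys ! j) (xs ! i)}"
        using less cyc_less_trans j i len by auto
    qed
    then have "card {..i} \<le> card {j. j < length ys \<and> cyc_less r (ys ! j) (xs ! i)}"
      by (intro card_mono) auto
    then have "Suc i \<le> card {y \<in> B. cyc_less r y (xs ! i)}"
      using card_filter_set_distinct[OF dist(2), of "\<lambda>y. cyc_less r y (xs ! i)"] ys(2) by simp
    moreover have "xs ! i \<in> {1..n}" using i xs(2) A nth_mem by blast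
    ultimately show False using R by fastforce
  qed
  then show ?L
    unfolding subset_le_def using xs ys len
    by (intro exI[of _ xs] exI[of _ ys]) (auto simp: list_all2_conv_all_nth)
qed

section \<open>The tilted order as a minimum condition on \<open>prefix_excess\<close>\<close>

lemma prefix_set_subset:
  assumes "w permutes {1..n}" "k \<le> n"
  shows "prefix_set w k \<subseteq> {1..n}"
  using assms permutes_in_image[OF assms(1)] by (force simp: prefix_set_def)

lemma card_prefix_set_filter:
  assumes "w permutes {1..n}"
  shows "int (card {y \<in> prefix_set w k. P y}) = (\<Sum>m = 1..k. of_bool (P (w m)))"
proof -
  have inj: "inj_on w S" for S
    using permutes_inj[OF assms] by (rule inj_on_subset) simp
  have "{y \<in> prefix_set w k. P y} = w ` {m \<in> {1..k}. P (w m)}"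
    by (auto simp: prefix_set_def)
  then have "card {y \<in> prefix_set w k. P y} = card {m \<in> {1..k}. P (w m)}"
    using inj by (simp add: card_image)
  also have "int \<dots> = (\<Sum>m = 1..k. of_bool (P (w m)))"
    by (simp add: Int_def)
  finally show ?thesis .
qed

text \<open>Summing \<open>of_bool_cyc_less\<close> over both prefixes, the terms
  \<open>of_bool (x < r)\<close> cancel, since each prefix has \<open>k\<close> positions.\<close>

lemma card_prefix_set_diff:
  assumes "u permutes {1..n}" "v permutes {1..n}"
  shows "int (card {y \<in> prefix_set u k. cyc_less r y x}) -
    int (card {y \<in> prefix_set v k. cyc_less r y x}) = prefix_excess u v k x - prefix_excess u v k r"
  unfolding card_prefix_set_filter[OF assms(1)] card_prefix_set_filter[OF assms(2)]
    prefix_excess_def sum_subtractf[symmetric] of_bool_cyc_less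
  by (intro sum.cong) auto

lemma card_prefix_set:
  assumes "w permutes {1..n}"
  shows "card (prefix_set w k) = k"
  using card_prefix_set_filter[OF assms, of k "\<lambda>_. True"] by simp

text \<open>The interval is an initial segment of the order starting at \<open>r\<close>, so both
  conditions of the tilted order compare the same kind of counts.\<close>

lemma prefix_set_Int_cyc_interval:
  assumes "w permutes {1..n}" "k \<le> n"
  shows "prefix_set w k \<inter> cyc_interval n r x = {y \<in> prefix_set w k. cyc_less r y x}"
  using prefix_set_subset[OF assms] by (auto simp: cyc_interval_def cyc_less_def split: if_splits)

lemma tilted_le_iff:
  assumes a: "a \<in> {1..n} \<rightarrow> {1..n}" and u: "u permutes {1..n}" and v: "v permutes {1..n}"
  shows "tilted_le n a u v \<longleftrightarrow>
    (\<forall>k\<in>{1..n}. \<forall>x\<in>{1..n}. prefix_excess u v k (a k) \<le> prefix_excess u v k x) \<and>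
    (\<forall>k\<in>{1..<n}. prefix_excess u v k (a k) = prefix_excess u v k (a (k + 1)))"
proof -
  have "subset_le (a k) (prefix_set u k) (prefix_set v k) \<longleftrightarrow>
      (\<forall>x\<in>{1..n}. prefix_excess u v k (a k) \<le> prefix_excess u v k x)" if "k \<in> {1..n}" for k
  proof -
    have "card {y \<in> prefix_set v k. cyc_less (a k) y x} \<le> card {y \<in> prefix_set u k. cyc_less (a k) y x}
      \<longleftrightarrow> prefix_excess u v k (a k) \<le> prefix_excess u v k x" for x
      using card_prefix_set_diff[OF u v, of k "a k" x] by linarith
    moreover have "a k \<in> {1..n}" using a that by blast
    ultimately show ?thesis
      using that by (subst subset_le_iff[OF prefix_set_subset[OF u] prefix_set_subset[OF v]])
        (auto simp: card_prefix_set[OF u] card_prefix_set[OF v])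
  qed
  moreover have "card (prefix_set u k \<inter> cyc_interval n (a k) (a (k + 1))) =
      card (prefix_set v k \<inter> cyc_interval n (a k) (a (k + 1))) \<longleftrightarrow>
      prefix_excess u v k (a k) = prefix_excess u v k (a (k + 1))" if "k \<in> {1..<n}" for k
  proof -
    have "k \<le> n" using that by simp
    then show ?thesis
      unfolding prefix_set_Int_cyc_interval[OF u \<open>k \<le> n\<close>] prefix_set_Int_cyc_interval[OF v \<open>k \<le> n\<close>]
      using card_prefix_set_diff[OF u v, of k "a k" "a (k + 1)"] by linarith
  qed
  ultimately show ?thesis unfolding tilted_le_def by auto
qed

lemma prefix_excess_add: "prefix_excess u v k x + prefix_excess v w k x = prefix_excess u w k x"
  unfolding prefix_excess_def sum.distrib[symmetric] by (intro sum.cong) auto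

lemma prefix_excess_eq_0_outside:
  assumes u: "u permutes {1..n}" and v: "v permutes {1..n}" and k: "k \<le> n" and x: "x \<notin> {2..n}"
  shows "prefix_excess u v k x = 0"
proof -
  have "(of_bool (u m < x) :: int) = of_bool (v m < x)" if "m \<in> {1..k}" for m
  proof -
    have "u m \<in> {1..n}" "v m \<in> {1..n}"
      using that k permutes_in_image[OF u] permutes_in_image[OF v] by auto
    then show ?thesis using x by auto
  qed
  then show ?thesis by (simp add: prefix_excess_def)
qed

text \<open>A threshold outside \<open>{1..n}\<close> gives 0, as the threshold 1 does, so the
  minimum extends to every natural number. This is needed at \<open>Suc (v i)\<close>, which may be
  \<open>n + 1\<close>.\<close>

lemma tilted_le_excess_min:
  assumes a: "a \<in> {1..n} \<rightarrow> {1..n}" and u: "u permutes {1..n}" and v: "v permutes {1..n}"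
    and le: "tilted_le n a u v" and k: "k \<in> {1..n}"
  shows "prefix_excess u v k (a k) \<le> prefix_excess u v k x"
proof -
  have min: "\<forall>x\<in>{1..n}. prefix_excess u v k (a k) \<le> prefix_excess u v k x"
    using le k unfolding tilted_le_iff[OF a u v] by blast
  show ?thesis
  proof (cases "x \<in> {1..n}")
    case True
    then show ?thesis using min by blast
  next
    case False
    have "1 \<in> {1..n}" using k by auto
    then show ?thesis
      using min prefix_excess_eq_0_outside[OF u v, of k x] prefix_excess_eq_0_outside[OF u v, of k 1]
        False k by fastforce
  qed
qed

section \<open>Partial order axioms\<close>

lemma tilted_le_refl:
  assumes "a \<in> {1..n} \<rightarrow> {1..n}" "u permutes {1..n}"
  shows "tilted_le n a u u"
  unfolding tilted_le_iff[OF assms assms(2)] by (simp add: prefix_excess_def)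

lemma tilted_le_trans:
  assumes a: "a \<in> {1..n} \<rightarrow> {1..n}"
    and u: "u permutes {1..n}" and v: "v permutes {1..n}" and w: "w permutes {1..n}"
    and "tilted_le n a u v" "tilted_le n a v w"
  shows "tilted_le n a u w"
  using assms(5,6) unfolding tilted_le_iff[OF a u v] tilted_le_iff[OF a v w] tilted_le_iff[OF a u w]
    prefix_excess_add[of u v _ _ w, symmetric]
  by (auto intro: add_mono)

lemma eq_if_prefix_excess_eq_0:
  assumes u: "u permutes {1..n}" and v: "v permutes {1..n}"
    and 0: "\<And>k x. k \<le> n \<Longrightarrow> prefix_excess u v k x = 0"
  shows "u = v"
proof
  fix m
  show "u m = v m"
  proof (cases "m \<in> {1..n}")
    case True
    then obtain k where k: "m = Suc k" "Suc k \<le> n" by (cases m) auto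
    have "(of_bool (u m < x) :: int) = of_bool (v m < x)" for x
      using 0[of k x] 0[of "Suc k" x] k by (simp add: prefix_excess_def)
    \<comment> \<open>The first threshold gives \<open>v m \<le> u m\<close>, the second the
      reverse.\<close>
    from this[of "Suc (u m)"] this[of "Suc (v m)"] show ?thesis by simp
  next
    case False
    then show ?thesis using u v by (metis permutes_not_in)
  qed
qed

text \<open>The excess and its negative are both minimal at \<open>a k\<close>, so each row is
  constant, and it vanishes at threshold 0.\<close>

lemma tilted_le_antisym:
  assumes a: "a \<in> {1..n} \<rightarrow> {1..n}" and u: "u permutes {1..n}" and v: "v permutes {1..n}"
    and "tilted_le n a u v" "tilted_le n a v u"
  shows "u = v"
proof (rule eq_if_prefix_excess_eq_0[OF u v])
  fix k x assume k: "k \<le> n"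
  have neg: "prefix_excess v u k y = - prefix_excess u v k y" for y
    unfolding prefix_excess_def sum_negf[symmetric] by (intro sum.cong) auto
  show "prefix_excess u v k x = 0"
  proof (cases "k = 0")
    case False
    then have "k \<in> {1..n}" using k by simp
    then have "prefix_excess u v k y = prefix_excess u v k (a k)" for y
      using tilted_le_excess_min[OF a u v assms(4), of k y]
        tilted_le_excess_min[OF a v u assms(5), of k y] neg by fastforce
    from this[of x] this[of 0] show ?thesis
      using prefix_excess_eq_0_outside[OF u v k, of 0] by simp
  qed (simp add: prefix_excess_def)
qed

section \<open>Exchanging two entries\<close>

lemma prefix_excess_transpose:
  assumes "1 \<le> i" "i < j"
  shows "prefix_excess u (u \<circ> transpose i j) k x =
    (if i \<le> k \<and> k < j then of_bool (u i < x) - of_bool (u j < x) else 0)"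
proof -
  have "prefix_excess u (u \<circ> transpose i j) k x =
      (\<Sum>m = 1..k. (of_bool (m = i) - of_bool (m = j)) * (of_bool (u i < x) - of_bool (u j < x)))"
    unfolding prefix_excess_def by (intro sum.cong) (auto simp: transpose_def)
  also have "\<dots> = (\<Sum>m = 1..k. of_bool (m = i) - of_bool (m = j)) * (of_bool (u i < x) - of_bool (u j < x))"
    by (simp only: sum_distrib_right)
  \<comment> \<open>From position \<open>j\<close> on, the prefix contains both exchanged entries
    and the contributions cancel.\<close>
  also have "(\<Sum>m = 1..k. of_bool (m = i) - of_bool (m = j) :: int) = of_bool (i \<le> k) - of_bool (j \<le> k)"
    using assms by (simp add: sum_subtractf of_bool_def)
  finally show ?thesis using assms by (simp del: comp_apply)
qed

text \<open>By \<open>rect\<close>, no minimum of a row \<open>k\<close> in \<open>[i, j)\<close>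
  lies in the arc \<open>(u i, u j]\<close>. Since \<open>a k\<close> and \<open>a (k + 1)\<close>
  are both minima of row \<open>k\<close>, they avoid the arc, where the exchange acts.\<close>

lemma tilted_le_transpose:
  assumes a: "a \<in> {1..n} \<rightarrow> {1..n}" and u: "u permutes {1..n}" and v: "v permutes {1..n}"
    and le: "tilted_le n a u v" and ij: "1 \<le> i" "i < j" "j \<le> n"
    and rect: "\<And>k x. i \<le> k \<Longrightarrow> k < j \<Longrightarrow> cyc_between (u i) (u j) x \<Longrightarrow>
      prefix_excess u v k (a k) < prefix_excess u v k x"
  shows "\<And>k. i \<le> k \<Longrightarrow> k \<le> j \<Longrightarrow> \<not> cyc_between (u i) (u j) (a k)"
    and "tilted_le n a u (u \<circ> transpose i j)" and "tilted_le n a (u \<circ> transpose i j) v"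
proof -
  let ?z = "u \<circ> transpose i j"
  have z: "?z permutes {1..n}"
    using ij by (intro permutes_compose[OF _ u] permutes_swap_id) auto
  have "u i \<noteq> u j" using ij permutes_inj[OF u] by (auto dest: injD)
  then have ind: "of_bool (u i < x) - of_bool (u j < x) =
      (of_bool (cyc_between (u i) (u j) x) - of_bool (u j < u i) :: int)" for x
    by (simp add: of_bool_cyc_between)
  have stair: "prefix_excess u v k (a k) = prefix_excess u v k (a (k + 1))" if "k \<in> {1..<n}" for k
    using le that unfolding tilted_le_iff[OF a u v] by blast
  show avoid: "\<not> cyc_between (u i) (u j) (a k)" if "i \<le> k" "k \<le> j" for k
  proof (cases "k = j")
    case True
    \<comment> \<open>Row \<open>j\<close> is outside the rectangle, but \<open>a j\<close> is also
      a minimum of row \<open>j - 1\<close>.\<close>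
    then show ?thesis using rect[of "j - 1" "a k"] stair[of "j - 1"] ij by fastforce
  next
    case False
    then show ?thesis using rect[of k "a k"] that by fastforce
  qed
  have uz: "prefix_excess u ?z k x = (if i \<le> k \<and> k < j then
      of_bool (cyc_between (u i) (u j) x) - of_bool (u j < u i) else 0)" for k x
    unfolding prefix_excess_transpose[OF ij(1,2)] ind ..
  show "tilted_le n a u ?z"
    unfolding tilted_le_iff[OF a u z] uz using avoid by auto
  have zv: "prefix_excess ?z v k x = prefix_excess u v k x - prefix_excess u ?z k x" for k x
    using prefix_excess_add[of u ?z k x v] by simp
  \<comment> \<open>Within an affected row, the exchange lowers the arc by one relative to the rest;
    the strict integer inequality \<open>rect\<close> keeps \<open>a k\<close> minimal.\<close>
  have "prefix_excess ?z v k (a k) \<le> prefix_excess ?z v k x" if "k \<in> {1..n}" for k x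
    using rect[of k x] tilted_le_excess_min[OF a u v le that, of x] avoid[of k]
    unfolding zv uz by auto
  moreover have "prefix_excess ?z v k (a k) = prefix_excess ?z v k (a (k + 1))" if "k \<in> {1..<n}" for k
    using stair[OF that] avoid[of k] avoid[of "k + 1"] unfolding zv uz by auto
  ultimately show "tilted_le n a ?z v" unfolding tilted_le_iff[OF a z v] by blast
qed

section \<open>Change of the tilted length under an exchange\<close>

lemma tilted_length_eq_sum:
  "int (tilted_length n a w) =
    (\<Sum>p = 1..n. \<Sum>q = 1..n. of_bool (p < q \<and> cyc_less (a p) (w q) (w p)))"
proof -
  have "{(i, j). 1 \<le> i \<and> i < j \<and> j \<le> n \<and> cyc_less (a i) (w j) (w i)} =
      Sigma {1..n} (\<lambda>p. {1..n} \<inter> {q. p < q \<and> cyc_less (a p) (w q) (w p)})"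
    by force
  then show ?thesis unfolding tilted_length_def by simp
qed

text \<open>Cutting the circle just before \<open>r\<close> leaves the arc from \<open>x\<close> to
  \<open>y\<close> in one piece, so \<open>x\<close> is met first.\<close>

lemma cyc_less_avoid:
  assumes "\<not> cyc_between x y r" "x \<noteq> y"
  shows "cyc_less r x y" "\<not> cyc_less r y x"
  using assms unfolding cyc_between_def cyc_less_def by presburger+

text \<open>With the arc uncut, the values that lie on different sides of \<open>x\<close> and of
  \<open>y\<close> are exactly those inside the arc.\<close>

lemma of_bool_cyc_less_avoid:
  assumes "\<not> cyc_between x y r" "x \<noteq> y" "w \<noteq> x" "w \<noteq> y"
  shows "(of_bool (cyc_less r w y) :: int) = of_bool (cyc_less r w x) + of_bool (cyc_between x y w)"
    and "(of_bool (cyc_less r x w) :: int) = of_bool (cyc_less r y w) + of_bool (cyc_between x y w)"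
proof -
  have avoid: "of_bool (x < r) - of_bool (y < r) + of_bool (y < x) = (0 :: int)"
    using of_bool_cyc_between[OF assms(2), of r] assms(1) by simp
  have flip: "of_bool (w < x) = (1 - of_bool (x < w) :: int)"
      "of_bool (w < y) = (1 - of_bool (y < w) :: int)"
    using assms(3,4) by auto
  show "(of_bool (cyc_less r w y) :: int) = of_bool (cyc_less r w x) + of_bool (cyc_between x y w)"
    unfolding of_bool_cyc_less of_bool_cyc_between[OF assms(2)] flip using avoid by linarith
  show "(of_bool (cyc_less r x w) :: int) = of_bool (cyc_less r y w) + of_bool (cyc_between x y w)"
    unfolding of_bool_cyc_less of_bool_cyc_between[OF assms(2)] using avoid by linarith
qed

text \<open>The pair \<open>(i, j)\<close> becomes an inversion, by \<open>avoid\<close>. Pairs with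
  one position strictly between \<open>i\<close> and \<open>j\<close> keep their status, by
  \<open>empty\<close>; all remaining changes cancel in twos.\<close>

lemma tilted_length_transpose:
  assumes u: "u permutes {1..n}" and ij: "1 \<le> i" "i < j" "j \<le> n"
    and avoid: "\<And>k. i \<le> k \<Longrightarrow> k \<le> j \<Longrightarrow> \<not> cyc_between (u i) (u j) (a k)"
    and empty: "\<And>m. i < m \<Longrightarrow> m < j \<Longrightarrow> \<not> cyc_between (u i) (u j) (u m)"
  shows "tilted_length n a (u \<circ> transpose i j) = tilted_length n a u + 1"
proof -
  let ?z = "u \<circ> transpose i j"
  \<comment> \<open>For \<open>p < i\<close>, the pairs \<open>(p, i)\<close> and
    \<open>(p, j)\<close> change by \<open>\<beta> p\<close> and \<open>- \<beta> p\<close>. For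
    \<open>q > j\<close>, the pairs \<open>(i, q)\<close> and \<open>(j, q)\<close> change by
    \<open>\<gamma> q\<close> and \<open>- \<gamma> q\<close>: the same \<open>\<gamma>\<close>
    serves both rows because \<open>a i\<close> and \<open>a j\<close> both avoid the arc.\<close>
  define \<beta> :: "nat \<Rightarrow> int" where "\<beta> p =
    of_bool (p < i) * (of_bool (cyc_less (a p) (u j) (u p)) - of_bool (cyc_less (a p) (u i) (u p)))" for p
  define \<gamma> :: "nat \<Rightarrow> int" where "\<gamma> q = of_bool (j < q \<and> cyc_between (u i) (u j) (u q))" for q
  have inj: "u x = u y \<longleftrightarrow> x = y" for x y using permutes_inj[OF u] by (auto dest: injD)
  have pointwise: "of_bool (p < q \<and> cyc_less (a p) (?z q) (?z p)) -
      of_bool (p < q \<and> cyc_less (a p) (u q) (u p)) =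
      of_bool (p = i) * of_bool (q = j) + \<beta> p * (of_bool (q = i) - of_bool (q = j))
      + (of_bool (p = i) - of_bool (p = j)) * \<gamma> q" for p q
  proof -
    consider "p = i" "q = j" | "p = i" "i < q" "q < j" | "p = i" "j < q" | "p = j" "j < q"
      | "p < i" "q = i" | "p < i" "q = j" | "i < p" "p < j" "q = j"
      | "q \<le> p" | "p < q" "p \<notin> {i, j}" "q \<notin> {i, j}"
      using ij by (metis insertE empty_iff linorder_neqE_nat not_le)
    then show ?thesis
    proof cases
      case 1
      then show ?thesis
        using cyc_less_avoid[OF avoid[of i]] ij inj[of i j] by (simp add: \<beta>_def \<gamma>_def)
    next
      case 2
      then have "u q \<noteq> u i" "u q \<noteq> u j" "u i \<noteq> u j" using inj by simp_all
      then show ?thesis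
        using of_bool_cyc_less_avoid(1)[OF avoid[of i], of "u q"] empty[of q] 2 ij
        by (simp add: \<beta>_def \<gamma>_def)
    next
      case 3
      then have "u q \<noteq> u i" "u q \<noteq> u j" "u i \<noteq> u j" using inj ij by simp_all
      then show ?thesis
        using of_bool_cyc_less_avoid(1)[OF avoid[of i], of "u q"] 3 ij
        by (simp add: \<beta>_def \<gamma>_def)
    next
      case 4
      then have "u q \<noteq> u i" "u q \<noteq> u j" "u i \<noteq> u j" using inj ij by simp_all
      then show ?thesis
        using of_bool_cyc_less_avoid(1)[OF avoid[of j], of "u q"] 4 ij
        by (simp add: \<beta>_def \<gamma>_def)
    next
      case 7
      then have "u p \<noteq> u i" "u p \<noteq> u j" "u i \<noteq> u j" using inj by simp_all
      then show ?thesis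
        using of_bool_cyc_less_avoid(2)[OF avoid[of p], of "u p"] empty[of p] 7 ij
        by (simp add: \<beta>_def \<gamma>_def)
    qed (use ij in \<open>simp_all add: \<beta>_def \<gamma>_def\<close>)
  qed
  have delta: "(\<Sum>p = 1..n. of_bool (p = i) :: int) = 1" "(\<Sum>p = 1..n. of_bool (p = j) :: int) = 1"
    using ij by (simp_all add: of_bool_def)
  have "int (tilted_length n a ?z) - int (tilted_length n a u) =
      (\<Sum>p = 1..n. \<Sum>q = 1..n. of_bool (p = i) * of_bool (q = j) + \<beta> p * (of_bool (q = i) - of_bool (q = j))
      + (of_bool (p = i) - of_bool (p = j)) * \<gamma> q)"
    unfolding tilted_length_eq_sum sum_subtractf[symmetric] pointwise ..
  \<comment> \<open>Each correction factors into a product in which one factor is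
    \<open>1 - 1\<close>.\<close>
  also have "\<dots> = (\<Sum>p = 1..n. of_bool (p = i)) * (\<Sum>q = 1..n. of_bool (q = j))
      + (\<Sum>p = 1..n. \<beta> p) * (\<Sum>q = 1..n. of_bool (q = i) - of_bool (q = j))
      + (\<Sum>p = 1..n. of_bool (p = i) - of_bool (p = j)) * (\<Sum>q = 1..n. \<gamma> q)"
    by (simp only: sum.distrib sum_product)
  also have "\<dots> = 1" unfolding sum_subtractf delta by simp
  finally show ?thesis by linarith
qed

section \<open>Unit steps below a given element and strict monotonicity\<close>

lemma tilted_le_step:
  assumes a: "a \<in> {1..n} \<rightarrow> {1..n}" and u: "u permutes {1..n}" and v: "v permutes {1..n}"
    and le: "tilted_le n a u v" and "u \<noteq> v"
  obtains z where "z permutes {1..n}" "tilted_le n a u z" "tilted_le n a z v"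
    "tilted_length n a z = tilted_length n a u + 1"
proof -
  define i where "i = (LEAST m. u m \<noteq> v m)"
  have "\<exists>m. u m \<noteq> v m" using \<open>u \<noteq> v\<close> by blast
  then have neq: "u i \<noteq> v i" unfolding i_def by (rule LeastI_ex)
  have eq: "u m = v m" if "m < i" for m
    using that not_less_Least unfolding i_def by blast
  have i: "i \<in> {1..n}" using neq u v by (metis permutes_not_in)
  define Q where "Q m \<longleftrightarrow> i < m \<and> cyc_between (u i) (v i) (u m)" for m
  define j where "j = (LEAST m. Q m)"
  \<comment> \<open>The position of the value \<open>v i\<close> in \<open>u\<close> shows that
    \<open>j\<close> exists. It lies after \<open>i\<close>, because \<open>u\<close> and
    \<open>v\<close> agree before \<open>i\<close> and \<open>v\<close> is injective.\<close>
  obtain m where m: "u m = v i" using permutes_surj[OF u] by (metis surjD)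
  have "i < m"
  proof (rule ccontr)
    assume "\<not> i < m"
    moreover have "m \<noteq> i" using m neq by auto
    ultimately have "m < i" by simp
    then have "v m = v i" using eq m by simp
    then show False using \<open>m < i\<close> permutes_inj[OF v] by (auto dest: injD)
  qed
  then have "Q m" using m by (auto simp: Q_def cyc_between_def)
  then have Qj: "Q j" and least: "\<And>m. m < j \<Longrightarrow> \<not> Q m"
    unfolding j_def by (auto intro: LeastI dest: not_less_Least)
  have ij: "1 \<le> i" "i < j" using i Qj by (auto simp: Q_def)
  have uj: "cyc_between (u i) (v i) (u j)" using Qj by (simp add: Q_def)
  have "m \<le> n" using m i v \<open>i < m\<close> neq permutes_not_in[OF u, of m] permutes_in_image[OF v, of i] by fastforce
  then have jn: "j \<le> n" using least \<open>Q m\<close> by (meson leI le_trans)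
  have sub: "cyc_between (u i) (v i) x" if "cyc_between (u i) (u j) x" for x
    using that uj neq by (auto simp: cyc_between_def split: if_splits)
  have rect: "prefix_excess u v k (a k) < prefix_excess u v k x"
    if k: "i \<le> k" "k < j" and x: "cyc_between (u i) (u j) x" for k x
  proof -
    \<comment> \<open>Compare \<open>x\<close> with the threshold just past the arc
      \<open>(u i, v i]\<close>. Positions before \<open>i\<close> cancel; at \<open>i\<close> only
      \<open>v\<close> has its entry in the cyclic segment \<open>[x, v i]\<close>, giving -1; from
      \<open>i + 1\<close> to \<open>k < j\<close>, \<open>u\<close> has no entry there, so
      \<open>v\<close> can only lower the difference.\<close>
    have "prefix_excess u v k (Suc (v i)) - prefix_excess u v k x \<le> (\<Sum>m = 1..k. - of_bool (m = i))"
      unfolding prefix_excess_def sum_subtractf[symmetric]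
    proof (rule sum_mono)
      fix m assume "m \<in> {1..k}"
      show "of_bool (u m < Suc (v i)) - of_bool (v m < Suc (v i)) -
          (of_bool (u m < x) - of_bool (v m < x)) \<le> - (of_bool (m = i) :: int)"
      proof (cases m i rule: linorder_cases)
        case less
        then show ?thesis using eq by simp
      next
        case equal
        then show ?thesis using sub[OF x] neq by (auto simp: cyc_between_def split: if_splits)
      next
        case greater
        then have "\<not> cyc_between (u i) (v i) (u m)"
          using least[of m] k \<open>m \<in> {1..k}\<close> by (auto simp: Q_def)
        then show ?thesis
          using sub[OF x] neq greater by (auto simp: cyc_between_def split: if_splits)
      qed
    qed
    also have "\<dots> = - 1" using ij k by (simp add: sum_negf of_bool_def)
    finally show ?thesis
      using tilted_le_excess_min[OF a u v le, of k "Suc (v i)"] k ij jn by fastforce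
  qed
  have avoid: "\<not> cyc_between (u i) (u j) (a k)" if "i \<le> k" "k \<le> j" for k
    by (rule tilted_le_transpose(1)[OF a u v le ij jn _ that]) (rule rect)
  show thesis
  proof (rule that)
    show "u \<circ> transpose i j permutes {1..n}"
      using ij jn by (intro permutes_compose[OF _ u] permutes_swap_id) auto
    show "tilted_length n a (u \<circ> transpose i j) = tilted_length n a u + 1"
      using avoid least sub by (intro tilted_length_transpose[OF u ij jn]) (auto simp: Q_def)
    show "tilted_le n a u (u \<circ> transpose i j)"
      by (rule tilted_le_transpose(2)[OF a u v le ij jn]) (rule rect)
    show "tilted_le n a (u \<circ> transpose i j) v"
      by (rule tilted_le_transpose(3)[OF a u v le ij jn]) (rule rect)
  qed
qed

lemma tilted_length_bound: "tilted_length n a w \<le> n * n"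
proof -
  have "tilted_length n a w \<le> card ({1..n} \<times> {1..n})"
    unfolding tilted_length_def by (intro card_mono) auto
  then show ?thesis by simp
qed

lemma tilted_length_strict_mono:
  assumes a: "a \<in> {1..n} \<rightarrow> {1..n}" and u: "u permutes {1..n}" and v: "v permutes {1..n}"
    and "tilted_le n a u v" "u \<noteq> v"
  shows "tilted_length n a u < tilted_length n a v"
  using u assms(4,5)
\<comment> \<open>Steps are iterated towards \<open>v\<close>; the crude bound \<open>n * n\<close>
  on the length makes this terminate.\<close>
proof (induction "n * n - tilted_length n a u" arbitrary: u rule: less_induct)
  case less
  obtain z where z: "z permutes {1..n}" "tilted_le n a z v"
    "tilted_length n a z = tilted_length n a u + 1"
    using tilted_le_step[OF a less.prems(1) v less.prems(2,3)] by blast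
  show ?case
  proof (cases "z = v")
    case False
    have "n * n - tilted_length n a z < n * n - tilted_length n a u"
      using z(3) tilted_length_bound[of n a z] by simp
    then show ?thesis using less.hyps z False by fastforce
  qed (use z in simp)
qed

section \<open>The poset and its covering relations\<close>

lemma partial_order_on_tilted_order:
  assumes a: "a \<in> {1..n} \<rightarrow> {1..n}"
  shows "partial_order_on {w. w permutes {1..n}} (tilted_order n a)"
  unfolding tilted_order_def
proof (rule partial_order_on_relation_ofI)
  show "tilted_le n a u u" if "u \<in> {w. w permutes {1..n}}" for u
    using that tilted_le_refl[OF a] by simp
  show "tilted_le n a u w"
    if "u \<in> {w. w permutes {1..n}}" "v \<in> {w. w permutes {1..n}}" "w \<in> {w. w permutes {1..n}}"
      "tilted_le n a u v" "tilted_le n a v w" for u v w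
    using that tilted_le_trans[OF a, of u v w] by simp
  show "u = v"
    if "u \<in> {w. w permutes {1..n}}" "v \<in> {w. w permutes {1..n}}"
      "tilted_le n a u v" "tilted_le n a v u" for u v
    using that tilted_le_antisym[OF a, of u v] by simp
qed

theorem theorem3p18:
  fixes n :: nat and a :: "nat \<Rightarrow> nat"
  assumes "a \<in> {1..n} \<rightarrow> {1..n}"
  shows "(\<forall>w w'. covered_by (tilted_order n a) w w' \<longrightarrow>
            tilted_length n a w' = tilted_length n a w + 1) \<and>
         ranked_poset_on {w. w permutes {1..n}} (tilted_order n a) (tilted_length n a)"
proof -
  have in_order: "(u, v) \<in> tilted_order n a \<longleftrightarrow>
      u permutes {1..n} \<and> v permutes {1..n} \<and> tilted_le n a u v" for u v
    by (auto simp: tilted_order_def relation_of_def)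
  have cover: "tilted_length n a w' = tilted_length n a w + 1"
    if "covered_by (tilted_order n a) w w'" for w w'
  proof -
    have w: "w permutes {1..n}" "w' permutes {1..n}" "tilted_le n a w w'" "w \<noteq> w'"
      and no: "\<And>z. (w, z) \<in> tilted_order n a \<Longrightarrow> (z, w') \<in> tilted_order n a \<Longrightarrow> z \<in> {w, w'}"
      using that unfolding covered_by_def in_order by blast+
    obtain z where z: "z permutes {1..n}" "tilted_le n a w z" "tilted_le n a z w'"
      "tilted_length n a z = tilted_length n a w + 1"
      using tilted_le_step[OF assms w] by blast
    \<comment> \<open>The cover leaves only its two ends for \<open>z\<close>, and the longer length
      excludes \<open>w\<close>.\<close>
    then have "z \<in> {w, w'}" using w by (intro no) (auto simp: in_order)
    moreover have "z \<noteq> w" using z(4) by auto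
    ultimately show ?thesis using z(4) by auto
  qed
  then show ?thesis
    unfolding ranked_poset_on_def
    using partial_order_on_tilted_order[OF assms] tilted_length_strict_mono[OF assms]
    by (auto simp: in_order)
qed

end
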